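(* There is a Lebesgue measurable function $f:\mathbb{R}\to\mathbb{R}$ that is not in $\mathfrak{M}_{\omega_1}$, i.e. that is not of Mauldin class $\omega_1$, where $\omega_1$ is the first uncountable ordinal.
   Context: The Axiom of Choice is assumed (work in ZFC). A function $f:\mathbb{R}\to\mathbb{R}$ is Lebesgue measurable if the pre-image under $f$ of every Borel subset of $\mathbb{R}$ is a Lebesgue measurable set. A null set is a set of Lebesgue measure zero. A function $\mathbb{R}\to\mathbb{R}$ is continuous almost everywhere if it is continuous at every point outside some null set (i.e. its set of points of discontinuity is null). Mauldin classes are defined by transfinite recursion on ordinals: a function $f:\mathbb{R}\to\mathbb{R}$ is of Mauldin class $0$ if it is continuous almost everywhere; for an ordinal $\alpha>0$, $f$ is of Mauldin class $\alpha$ if it is a pointwise limit (everywhere on $\mathbb{R}$) of a sequence $(f_n)_{n\in\mathbb{N}}$ of functions $f_n:\mathbb{R}\to\mathbb{R}$, each of which is of Mauldin class $\alpha_n$ for some ordinal $\alpha_n<\alpha$ (possibly depending on $n$). The set of functions of Mauldin class $\alpha$ is denoted $\mathfrak{M}_\alpha$. *)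

theory Defs
  imports "HOL-Analysis.Analysis"
begin

unbundle cardinal_syntax

text \<open>
  An ordinal is represented by a well-order relation of that order type, and ordinals are
  compared by \<open><o\<close>. Every ordinal below the order type of a relation \<open>r\<close> is represented
  on the type of \<open>r\<close>, by a proper initial segment of \<open>r\<close>, so the quantification over
  \<open>s <o r\<close> below loses nothing by staying within that type. The ordinal 0 is the empty
  relation. If \<open>r\<close> is not a well-order, no \<open>s <o r\<close> exists and its class is empty.
\<close>

function Mauldin_class :: "'a rel \<Rightarrow> (real \<Rightarrow> real) set" where
  "Mauldin_class r =
     (if r = {} then {f. AE x in lebesgue. isCont f x}
      else {f. \<exists>F :: nat \<Rightarrow> real \<Rightarrow> real.
                 (\<forall>n. \<exists>s\<in>{s. s <o r}. F n \<in> Mauldin_class s) \<and>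
                 (\<forall>x. (\<lambda>n. F n x) \<longlonglongrightarrow> f x)})"
  by pat_completeness auto
termination
  by (relation ordLess) (auto intro: wf_ordLess)

declare Mauldin_class.simps [simp del]

text \<open>The first uncountable ordinal, as the cardinal successor of the order type of the naturals.\<close>

definition omega1 :: "nat set rel" where
  "omega1 = cardSuc natLeq"

lemma Card_order_omega1: "Card_order omega1"
  unfolding omega1_def by (simp add: cardSuc_Card_order natLeq_Card_order)

lemma countable_iff_ordLeq_natLeq: "countable A \<longleftrightarrow> |A| \<le>o natLeq"
proof -
  have "countable A \<longleftrightarrow> |A| \<le>o |UNIV :: nat set|"
    by (simp add: countable_def card_of_ordLeq[symmetric])
  then show ?thesis
    using card_of_nat ordLeq_ordIso_trans ordIso_symmetric by blast
qed

lemma uncountable_omega1: "uncountable (Field omega1)"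
proof
  assume "countable (Field omega1)"
  then have "|Field omega1| \<le>o natLeq"
    by (simp add: countable_iff_ordLeq_natLeq)
  moreover have "(omega1, |Field omega1| ) \<in> ordIso"
    using Card_order_omega1 card_of_Field_ordIso ordIso_symmetric by blast
  moreover have "natLeq <o omega1"
    unfolding omega1_def by (simp add: cardSuc_greater natLeq_Card_order)
  ultimately show False
    using not_ordLess_ordLeq ordIso_ordLeq_trans by blast
qed

lemma ordLess_omega1_countable:
  assumes "r <o omega1"
  shows "countable (Field r)"
proof -
  have "Well_order r"
    using assms by (simp add: ordLess_def)
  then have "|Field r| <o cardSuc natLeq"
    using assms card_of_least ordLeq_ordLess_trans unfolding omega1_def by blast
  then show ?thesis
    by (simp add: countable_iff_ordLeq_natLeq cardSuc_ordLess_ordLeq natLeq_Card_order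
        card_of_Card_order cardSuc_ordLeq_ordLess)
qed

text \<open>
  Mauldin classes depend only on the order type, also across types: the choice of the
  representing relation and of its underlying type is immaterial.
\<close>

lemma Mauldin_class_cong:
  fixes r :: "'a rel" and r' :: "'b rel"
  assumes "(r, r') \<in> ordIso"
  shows "Mauldin_class r = Mauldin_class r'"
  using assms
proof (induction r arbitrary: r' rule: wf_induct_rule[OF wf_ordLess])
  case (1 r)
  have "bij_betw f (Field r) (Field r') \<Longrightarrow> Field r = {} \<longleftrightarrow> Field r' = {}" for f
    by (auto simp: bij_betw_def)
  then have "Field r = {} \<longleftrightarrow> Field r' = {}"
    using "1.prems" by (auto simp: ordIso_def iso_def)
  then have empty: "r = {} \<longleftrightarrow> r' = {}"
    by (auto simp: Field_def)
  have "(\<exists>s\<in>{s :: 'a rel. s <o r}. f \<in> Mauldin_class s) \<longleftrightarrow>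
        (\<exists>s\<in>{s :: 'b rel. s <o r'}. f \<in> Mauldin_class s)" for f
  proof safe
    fix s :: "'a rel" assume s: "s <o r" "f \<in> Mauldin_class s"
    have "s <o r'"
      by (rule ordLess_ordIso_trans[OF s(1) "1.prems"])
    then obtain p :: "'b rel" where p: "(s, p) \<in> ordIso" "p <o r'"
      unfolding internalize_ordLess[of s r'] by blast
    show "\<exists>s\<in>{s :: 'b rel. s <o r'}. f \<in> Mauldin_class s"
      using "1.IH"[OF s(1) p(1)] s(2) p(2) by auto
  next
    fix s :: "'b rel" assume s: "s <o r'" "f \<in> Mauldin_class s"
    have "s <o r"
      by (rule ordLess_ordIso_trans[OF s(1) ordIso_symmetric[OF "1.prems"]])
    then obtain p :: "'a rel" where p: "(s, p) \<in> ordIso" "p <o r"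
      unfolding internalize_ordLess[of s r] by blast
    show "\<exists>s\<in>{s :: 'a rel. s <o r}. f \<in> Mauldin_class s"
      using "1.IH"[OF p(2) ordIso_symmetric[OF p(1)]] s(2) p(2) by auto
  qed
  then show ?case
    by (simp only: Mauldin_class.simps[of r] Mauldin_class.simps[of r'] empty)
qed

end

theory Submission
  imports Defs
begin

text \<open>
  The function is the indicator of a set that is negligible in measure but irregular in
  category. The class of sets with the Baire property (open up to a meager set) is a
  \<open>\<sigma>\<close>-algebra on the real line, and functions measurable with respect to it are closed under
  pointwise limits of sequences. An almost everywhere continuous function \<open>f\<close> is measurable in
  this sense: the failure of \<open>{f > y}\<close> to be open is covered by countably many closed sets of
  discontinuities, and a closed null set has empty interior (\<open>AE_isCont_Baire_measurable\<close>). By transfinite induction every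
  function of every Mauldin class, whatever the ordinal, is Baire measurable
  (\<open>Mauldin_class_Baire_measurable\<close>).

  Lebesgue measurable functions need not be. The line is the union of a null set \<open>G\<close> and a
  meager set (\<open>ex_negligible_comeager\<close>), and a Vitali set \<open>V\<close> lacks the Baire property
  (\<open>ex_not_Baire_property\<close>). The set \<open>V \<inter> G\<close> is null, hence Lebesgue measurable; since it
  differs from \<open>V\<close> by a meager set, it still lacks the Baire property.
\<close>

section \<open>Meager sets\<close>

definition meager :: "'a::topological_space set \<Rightarrow> bool" where
  "meager A \<longleftrightarrow> (\<exists>F :: nat \<Rightarrow> 'a set. (\<forall>n. closed (F n) \<and> interior (F n) = {}) \<and> A \<subseteq> (\<Union>n. F n))"

lemma meager_subset: "meager B \<Longrightarrow> A \<subseteq> B \<Longrightarrow> meager A"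
  unfolding meager_def by blast

lemma meagerE:
  fixes A :: "'a::topological_space set"
  assumes "meager A"
  obtains F :: "nat \<Rightarrow> 'a set"
  where "\<And>n. closed (F n)" "\<And>n. interior (F n) = {}" "A \<subseteq> (\<Union>n. F n)"
  using assms unfolding meager_def by blast

lemma meager_closed: "closed A \<Longrightarrow> interior A = {} \<Longrightarrow> meager A"
  unfolding meager_def by (rule exI[of _ "\<lambda>_. A"]) auto

lemma meager_empty [simp]: "meager {}"
  by (rule meager_closed) auto

lemma meager_UN:
  fixes A :: "nat \<Rightarrow> 'a::topological_space set"
  assumes "\<And>n. meager (A n)"
  shows "meager (\<Union>n. A n)"
proof -
  obtain F :: "nat \<Rightarrow> nat \<Rightarrow> 'a set" where
    F: "\<And>n k. closed (F n k)" "\<And>n k. interior (F n k) = {}" "\<And>n. A n \<subseteq> (\<Union>k. F n k)"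
    using assms unfolding meager_def by metis
  define H where "H m = F (fst (prod_decode m)) (snd (prod_decode m))" for m
  have "(\<Union>n. A n) \<subseteq> (\<Union>m. H m)"
  proof
    fix x assume "x \<in> (\<Union>n. A n)"
    then obtain n where "x \<in> A n" by blast
    then obtain k where "x \<in> F n k" using F(3) by blast
    then have "x \<in> H (prod_encode (n, k))" by (simp add: H_def)
    then show "x \<in> (\<Union>m. H m)" by blast
  qed
  moreover have "closed (H m)" "interior (H m) = {}" for m
    by (simp_all add: H_def F)
  ultimately show ?thesis
    unfolding meager_def by blast
qed

lemma meager_UN_countable:
  assumes "countable I" "\<And>i. i \<in> I \<Longrightarrow> meager (A i)"
  shows "meager (\<Union>i\<in>I. A i)"
proof (cases "I = {}")
  case False
  then have "(\<Union>i\<in>I. A i) = (\<Union>i\<in>range (from_nat_into I). A i)"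
    by (simp add: assms(1) range_from_nat_into)
  also have "\<dots> = (\<Union>n. A (from_nat_into I n))"
    by simp
  finally have "(\<Union>i\<in>I. A i) = (\<Union>n. A (from_nat_into I n))" .
  then show ?thesis
    using assms(2) False by (simp add: meager_UN from_nat_into)
qed auto

lemma meager_Un: "meager A \<Longrightarrow> meager B \<Longrightarrow> meager (A \<union> B)"
  using meager_UN_countable[of "{A, B}" "\<lambda>X. X"] by auto

lemma meager_translation:
  fixes A :: "'a::real_normed_vector set"
  assumes "meager A"
  shows "meager ((+) a ` A)"
proof -
  obtain F :: "nat \<Rightarrow> 'a set" where
    F: "\<And>n. closed (F n)" "\<And>n. interior (F n) = {}" "A \<subseteq> (\<Union>n. F n)"
    by (rule meagerE[OF assms]) blast
  have "meager ((+) a ` F n)" for n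
    using F(1,2)[of n] by (intro meager_closed closed_translation) (simp_all add: interior_translation)
  then have "meager (\<Union>n. (+) a ` F n)"
    by (rule meager_UN)
  then show ?thesis
    by (rule meager_subset) (use F(3) in blast)
qed

lemma not_meager_open:
  fixes U :: "'a::complete_space set"
  assumes "open U" "U \<noteq> {}"
  shows "\<not> meager U"
proof
  assume "meager U"
  then obtain F :: "nat \<Rightarrow> 'a set" where
    F: "\<And>n. closed (F n)" "\<And>n. interior (F n) = {}" "U \<subseteq> (\<Union>n. F n)"
    by (rule meagerE) blast
  have "euclidean interior_of \<Union>(range F) = {}"
    by (rule Baire_category_alt) (use F in \<open>auto simp: completely_metrizable_space_euclidean\<close>)
  then have "interior (\<Union>n. F n) = {}"
    by simp
  then show False
    using interior_maximal[OF F(3) assms(1)] assms(2) by blast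
qed

section \<open>The sigma-algebra of sets with the Baire property\<close>

definition Baire_property :: "'a::topological_space set \<Rightarrow> bool" where
  "Baire_property A \<longleftrightarrow> (\<exists>U. open U \<and> meager (A - U \<union> (U - A)))"

lemma meager_imp_Baire_property: "meager A \<Longrightarrow> Baire_property A"
  unfolding Baire_property_def by (rule exI[of _ "{}"]) auto

text \<open>
  If \<open>A\<close> is open up to a meager set, then \<open>- A\<close> is closed up to a meager set; the closed set
  may be replaced by its interior, since the frontier of a closed set is nowhere dense.
\<close>

lemma Baire_property_Compl:
  assumes "Baire_property A"
  shows "Baire_property (- A)"
proof -
  obtain U where U: "open U" "meager (A - U \<union> (U - A))"
    using assms unfolding Baire_property_def by blast
  have "interior (frontier (- U)) \<subseteq> interior (- U) \<inter> frontier (- U)"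
    using U(1) by (intro Int_greatest interior_mono interior_subset frontier_subset_closed) auto
  then have "interior (frontier (- U)) = {}"
    by (auto simp: frontier_def)
  then have "meager (frontier (- U))"
    by (intro meager_closed) auto
  then have "meager ((A - U \<union> (U - A)) \<union> frontier (- U))"
    using U(2) meager_Un by blast
  then have "meager (- A - interior (- U) \<union> (interior (- U) - - A))"
    by (rule meager_subset) (use interior_subset[of "- U"] U(1) in \<open>auto simp: frontier_def closed_Compl\<close>)
  then show ?thesis
    unfolding Baire_property_def by (intro exI[of _ "interior (- U)"]) auto
qed

lemma Baire_property_UN:
  fixes A :: "nat \<Rightarrow> 'a::topological_space set"
  assumes "\<And>n. Baire_property (A n)"
  shows "Baire_property (\<Union>n. A n)"
proof -
  obtain U where U: "\<And>n. open (U n)" "\<And>n. meager (A n - U n \<union> (U n - A n))"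
    using assms unfolding Baire_property_def by metis
  have "meager (\<Union>n. A n - U n \<union> (U n - A n))"
    using U(2) by (rule meager_UN)
  then have "meager ((\<Union>n. A n) - (\<Union>n. U n) \<union> ((\<Union>n. U n) - (\<Union>n. A n)))"
    by (rule meager_subset) auto
  then show ?thesis
    unfolding Baire_property_def using U(1) by blast
qed

text \<open>
  Packaging the algebra as a measure space makes the closure of measurable functions under
  pointwise limits applicable; the measure itself is the zero measure.
\<close>

definition Baire_algebra :: "'a::topological_space measure" where
  "Baire_algebra = sigma UNIV {A. Baire_property A}"

lemma space_Baire_algebra [simp]: "space Baire_algebra = UNIV"
  by (simp add: Baire_algebra_def)

lemma sets_Baire_algebra: "sets Baire_algebra = {A. Baire_property A}"
proof -
  have "sigma_algebra UNIV {A :: 'a set. Baire_property A}"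
    unfolding sigma_algebra_iff2
    by (auto simp: Compl_eq_Diff_UNIV[symmetric] meager_imp_Baire_property
        intro: Baire_property_Compl Baire_property_UN)
  then show ?thesis
    by (simp add: Baire_algebra_def sigma_algebra.sigma_sets_eq)
qed

section \<open>Mauldin classes consist of Baire measurable functions\<close>

text \<open>
  The set \<open>{f > y}\<close> is its own interior up to a meager set. Its points outside the interior are
  distributed over the sets \<open>{f \<ge> y + 1 / (n + 1)}\<close>. At a continuity point \<open>x\<close> in the closure of
  one of these, \<open>f x > y\<close>, so \<open>x\<close> is interior to \<open>{f > y}\<close>. Removing that interior from the
  closure therefore leaves a closed set of discontinuities; being null, it is nowhere dense.
  Closing up before removing the interior matters: a null set as such need not be meager.
\<close>

lemma AE_isCont_Baire_measurable:
  fixes f :: "'a::euclidean_space \<Rightarrow> real"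
  assumes "AE x in lebesgue. isCont f x"
  shows "f \<in> borel_measurable Baire_algebra"
proof (rule borel_measurableI_greater)
  fix y
  define I where "I = interior {x. y < f x}"
  define K where "K n = closure {x. y + 1 / real (Suc n) \<le> f x} - I" for n
  have disc: "\<not> isCont f x" if "x \<in> K n" for x n
  proof
    assume cont: "isCont f x"
    have "x \<in> closure {x. y + 1 / real (Suc n) \<le> f x}" "x \<notin> I"
      using that by (auto simp: K_def)
    then obtain s where s: "\<And>k. y + 1 / real (Suc n) \<le> f (s k)" "s \<longlonglongrightarrow> x"
      unfolding closure_sequential by blast
    have "(\<lambda>k. f (s k)) \<longlonglongrightarrow> f x"
      by (rule isCont_tendsto_compose[OF cont s(2)])
    then have "y + 1 / real (Suc n) \<le> f x"
      by (rule LIMSEQ_le_const) (use s(1) in blast)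
    moreover have "0 < 1 / real (Suc n)" by simp
    ultimately have "y < f x" by linarith
    then have "eventually (\<lambda>z. y < f z) (nhds x)"
      using cont order_tendstoD(1) unfolding isCont_def tendsto_at_iff_tendsto_nhds by blast
    then have "x \<in> I"
      unfolding I_def by (simp add: interior_def eventually_nhds) blast
    with \<open>x \<notin> I\<close> show False ..
  qed
  have "meager (K n)" for n
  proof (rule meager_closed)
    show "closed (K n)" unfolding K_def I_def by (intro closed_Diff) auto
    have "negligible {x. \<not> isCont f x}"
      using assms by (simp add: negligible_iff_null_sets completion.null_sets_iff_AE)
    then have "negligible (interior (K n))"
      by (rule negligible_subset) (use disc interior_subset in blast)
    then show "interior (K n) = {}"
      using open_not_negligible open_interior by blast
  qed
  then have "meager (\<Union>n. K n)"
    by (rule meager_UN)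
  moreover have "{x. y < f x} - I \<subseteq> (\<Union>n. K n)"
  proof safe
    fix x assume x: "y < f x" "x \<notin> I"
    then obtain n where "1 / real (Suc n) < f x - y"
      using nat_approx_posE[of "f x - y"] by auto
    then have "x \<in> {x. y + 1 / real (Suc n) \<le> f x}" by simp
    then have "x \<in> closure {x. y + 1 / real (Suc n) \<le> f x}"
      by (rule subsetD[OF closure_subset])
    then have "x \<in> K n"
      unfolding K_def using x(2) by (rule DiffI)
    then show "x \<in> (\<Union>n. K n)" by blast
  qed
  moreover have "I \<subseteq> {x. y < f x}" "open I"
    unfolding I_def by (auto simp: interior_subset)
  ultimately have "open I \<and> meager ({x. y < f x} - I \<union> (I - {x. y < f x}))"
    using meager_subset[of "\<Union>n. K n"] by (simp add: Diff_eq_empty_iff[THEN iffD2])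
  then have "Baire_property {x. y < f x}"
    unfolding Baire_property_def by blast
  then show "{x \<in> space Baire_algebra. y < f x} \<in> sets Baire_algebra"
    by (simp add: sets_Baire_algebra)
qed

text \<open>
  Transfinite induction covers all ordinals at once, since each class is reached from smaller
  ones by sequential limits, under which measurability is preserved.
\<close>

lemma Mauldin_class_Baire_measurable:
  fixes r :: "'a rel"
  shows "f \<in> Mauldin_class r \<Longrightarrow> f \<in> borel_measurable Baire_algebra"
proof (induction r arbitrary: f rule: wf_induct_rule[OF wf_ordLess])
  case (1 r)
  show ?case
  proof (cases "r = {}")
    case True
    then show ?thesis
      using "1.prems" by (simp add: Mauldin_class.simps[of "{}"] AE_isCont_Baire_measurable)
  next
    case False
    then obtain F :: "nat \<Rightarrow> real \<Rightarrow> real" where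
      F: "\<forall>n. \<exists>s :: 'a rel. s <o r \<and> F n \<in> Mauldin_class s" "\<forall>x. (\<lambda>n. F n x) \<longlonglongrightarrow> f x"
      using "1.prems" unfolding Mauldin_class.simps[of r] by auto
    have "F n \<in> borel_measurable Baire_algebra" for n
      using F(1) "1.IH" by auto
    then show ?thesis
      by (intro borel_measurable_LIMSEQ_real[of _ F f]) (use F(2) in blast)
  qed
qed

section \<open>A null set without the Baire property\<close>

text \<open>
  Open sets of arbitrarily small measure around the rationals are dense, so their intersection
  is null and its complement is meager.
\<close>

lemma ex_negligible_comeager:
  obtains G :: "real set" where "negligible G" "meager (- G)"
proof -
  have neg: "negligible (\<rat> :: real set)"
    by (simp add: negligible_iff_null_sets null_sets_completionI countable_imp_null_set_lborel countable_rat)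
  have "\<exists>T. open T \<and> (\<rat> :: real set) \<subseteq> T \<and> T - \<rat> \<in> lmeasurable \<and>
      measure lebesgue (T - \<rat>) < 1 / real (Suc n)" for n
  proof -
    have "\<rat> \<in> sets (lebesgue :: real measure)"
      using neg by (simp add: negligible_iff_null_sets null_setsD2)
    then obtain T :: "real set" where T: "open T" "\<rat> \<subseteq> T" "T - \<rat> \<in> lmeasurable"
        "emeasure lebesgue (T - \<rat>) < ennreal (1 / real (Suc n))"
      by (rule sets_lebesgue_outer_open[of \<rat> "1 / real (Suc n)"]) simp
    then have "measure lebesgue (T - \<rat>) < 1 / real (Suc n)"
      by (simp add: emeasure_eq_measure2 ennreal_less_iff)
    with T show ?thesis by blast
  qed
  then obtain T :: "nat \<Rightarrow> real set" where
    T: "\<And>n. open (T n)" "\<And>n. \<rat> \<subseteq> T n" "\<And>n. T n - \<rat> \<in> lmeasurable"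
       "\<And>n. measure lebesgue (T n - \<rat>) < 1 / real (Suc n)"
    by metis
  show thesis
  proof
    have "negligible ((\<Inter>n. T n) - \<rat>)"
      unfolding negligible_outer
    proof (intro allI impI)
      fix e :: real assume "0 < e"
      then obtain n where "1 / real (Suc n) < e"
        using nat_approx_posE by blast
      then show "\<exists>U. (\<Inter>n. T n) - \<rat> \<subseteq> U \<and> U \<in> lmeasurable \<and> measure lebesgue U < e"
        using T(3,4)[of n] by (intro exI[of _ "T n - \<rat>"]) auto
    qed
    with neg have "negligible (\<rat> \<union> ((\<Inter>n. T n) - \<rat>))"
      by (rule negligible_Un)
    then show "negligible (\<Inter>n. T n)"
      by (rule negligible_subset) blast
    have "meager (- T n)" for n
    proof (rule meager_closed)
      show "closed (- T n)" using T(1) by auto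
      show "interior (- T n) = {}"
      proof (rule ccontr)
        assume "interior (- T n) \<noteq> {}"
        then obtain x e where xe: "0 < e" "ball x e \<subseteq> - T n"
          by (meson ex_in_conv mem_interior)
        then obtain q where "q \<in> \<rat>" "x < q" "q < x + e"
          using Rats_dense_in_real[of x "x + e"] by auto
        then show False
          using xe(2) T(2)[of n] by (auto simp: subset_iff dist_real_def)
      qed
    qed
    then show "meager (- (\<Inter>n. T n))"
      by (simp add: meager_UN)
  qed
qed

text \<open>
  A Vitali set, one representative of each coset of the rationals, is not meager, since
  countably many translates cover the line. If it were open up to a meager set, it would
  therefore contain all of some interval but a meager set. Translating by a rational that is
  small against the length of the interval gives two such sets over a common subinterval, so that
  \<open>V\<close> would meet its translate, which the choice of representatives forbids.
\<close>

lemma ex_not_Baire_property: "\<exists>V :: real set. \<not> Baire_property V"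
proof -
  define rep where "rep x = (SOME y :: real. x - y \<in> \<rat>)" for x
  define V where "V = range rep"
  have rep: "x - rep x \<in> \<rat>" for x
    unfolding rep_def by (rule someI[of _ x]) simp
  have rep_cong: "rep x = rep y" if "x - y \<in> \<rat>" for x y
  proof -
    have "x - z \<in> \<rat> \<longleftrightarrow> y - z \<in> \<rat>" for z
      using that Rats_add[of "x - y" "y - z"] Rats_diff[of "x - z" "x - y"] by auto
    then show ?thesis by (simp add: rep_def)
  qed
  have unique: "v = w" if vw: "v \<in> V" "w \<in> V" "v - w \<in> \<rat>" for v w
  proof -
    have fixed: "rep u = u" if u: "u \<in> V" for u
    proof -
      obtain x where "u = rep x"
        using u unfolding V_def by blast
      then show ?thesis
        using rep_cong[OF rep[of x]] by simp
    qed
    have "v = rep v" using fixed[OF vw(1)] by simp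
    also have "\<dots> = rep w" using vw(3) by (rule rep_cong)
    also have "\<dots> = w" using vw(2) by (rule fixed)
    finally show ?thesis .
  qed
  have "\<not> meager V"
  proof
    assume "meager V"
    then have "meager (\<Union>q\<in>\<rat>. (+) q ` V)"
      by (intro meager_UN_countable meager_translation) (auto simp: countable_rat)
    moreover have "(\<Union>q\<in>\<rat>. (+) q ` V) = UNIV"
    proof (intro equalityI subset_UNIV subsetI)
      fix x
      have "x = (x - rep x) + rep x" by simp
      then show "x \<in> (\<Union>q\<in>\<rat>. (+) q ` V)"
        using rep[of x] unfolding V_def by blast
    qed
    ultimately show False
      using not_meager_open[of "UNIV :: real set"] by simp
  qed
  have "\<not> Baire_property V"
  proof
    assume "Baire_property V"
    then obtain U where U: "open U" and m: "meager (V - U \<union> (U - V))"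
      unfolding Baire_property_def by blast
    have "U \<noteq> {}"
      using m \<open>\<not> meager V\<close> by auto
    then obtain x where "x \<in> U" by blast
    then obtain e where e: "0 < e" "ball x e \<subseteq> U"
      using U open_contains_ball by blast
    obtain q where q: "q \<in> \<rat>" "0 < q" "q < e"
      using Rats_dense_in_real[OF e(1)] by blast
    \<comment> \<open>The translates of \<open>U\<close> and \<open>V\<close> by \<open>q\<close>: the former overlaps \<open>U\<close>, the latter misses \<open>V\<close>.\<close>
    define W where "W = U \<inter> (+) q ` U"
    have "x + q \<in> W"
      using \<open>x \<in> U\<close> e(2) q by (auto simp: W_def dist_real_def subset_iff)
    moreover have "open W"
      unfolding W_def using U by (intro open_Int open_translation)
    ultimately have "\<not> meager W"
      using not_meager_open by blast
    moreover have "W \<subseteq> (U - V) \<union> (+) q ` (U - V)"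
    proof
      fix z assume z: "z \<in> W"
      then obtain u where u: "u \<in> U" "z = q + u" unfolding W_def by blast
      have "z \<notin> V \<or> u \<notin> V"
        using unique[of z u] u(2) q by auto
      then show "z \<in> (U - V) \<union> (+) q ` (U - V)"
        using z u unfolding W_def by blast
    qed
    moreover have "meager (U - V)"
      using m by (rule meager_subset) auto
    then have "meager ((U - V) \<union> (+) q ` (U - V))"
      by (intro meager_Un meager_translation)
    ultimately show False
      using meager_subset by blast
  qed
  then show ?thesis ..
qed

theorem theorem2p2:
  shows "\<exists>f :: real \<Rightarrow> real. f \<in> borel_measurable lebesgue \<and> f \<notin> Mauldin_class omega1"
proof -
  obtain V :: "real set" where V: "\<not> Baire_property V"
    using ex_not_Baire_property by blast
  obtain G :: "real set" where G: "negligible G" "meager (- G)"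
    using ex_negligible_comeager .
  have "negligible (V \<inter> G)"
    using G(1) by (rule negligible_subset) auto
  then have "indicat_real (V \<inter> G) \<in> borel_measurable lebesgue"
    by (simp add: borel_measurable_indicator_iff negligible_imp_sets)
  moreover have "indicat_real (V \<inter> G) \<notin> Mauldin_class omega1"
  proof
    assume "indicat_real (V \<inter> G) \<in> Mauldin_class omega1"
    then have "V \<inter> G \<in> sets Baire_algebra"
      using Mauldin_class_Baire_measurable borel_measurable_indicator_iff[of "V \<inter> G" Baire_algebra]
      by auto
    moreover have "V - G \<in> sets Baire_algebra"
      using meager_imp_Baire_property[OF meager_subset[OF G(2)], of "V - G"]
      by (auto simp: sets_Baire_algebra)
    ultimately have "(V \<inter> G) \<union> (V - G) \<in> sets Baire_algebra"
      by (rule sets.Un)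
    then show False
      using V by (simp add: sets_Baire_algebra Int_Diff_Un)
  qed
  ultimately show ?thesis by blast
qed

end
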